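(* For every real $\varepsilon>0$ and every integer $d\geq 2$ it holds that $\psi_{\mathbb{Z}^d}(m)=O(m^{d+1+\varepsilon})$ as $m\to\infty$; that is, there exist constants $C>0$ and $m_0\in\mathbb{N}$ (depending only on $\varepsilon$ and $d$) such that $\psi_{\mathbb{Z}^d}(m)\leq C\,m^{d+1+\varepsilon}$ for all integers $m\geq m_0$.
   Context: A direction is a nonzero vector $s\in\mathbb{R}^d$. For a finite set $F\subseteq\mathbb{Z}^d$, the (discrete) X-ray of $F$ in direction $s$ is the function that assigns to each line parallel to $s$ the number of points of $F$ on that line. $\psi_{\mathbb{Z}^d}(m)$ denotes the minimum number $n$ for which there exist $m$ directions $s_1,\dots,s_m$, pairwise linearly independent and spanning $\mathbb{R}^d$, such that there are two different $n$-point sets in $\mathbb{Z}^d$ that have the same X-rays in each of the directions $s_1,\dots,s_m$. *)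

theory Defs
  imports "HOL-Analysis.Analysis"
begin

definition integer_lattice :: "(real ^ 'd) set" where
  "integer_lattice = {x. \<forall>i. x $ i \<in> \<int>}"

definition lines_parallel :: "'a::real_vector \<Rightarrow> 'a set set" where
  "lines_parallel s = {L. \<exists>p. L = range (\<lambda>t::real. p + t *\<^sub>R s)}"

definition xray :: "'a::real_vector \<Rightarrow> 'a set \<Rightarrow> 'a set \<Rightarrow> nat" where
  "xray s F = restrict (\<lambda>L. card (F \<inter> L)) (lines_parallel s)"

text \<open>
  The \<open>m\<close> directions form a set, which loses nothing: pairwise linearly independent
  directions are distinct.
\<close>

definition admissible_directions :: "nat \<Rightarrow> 'a::real_vector set \<Rightarrow> bool" where
  "admissible_directions m S \<longleftrightarrow>
     finite S \<and> card S = m \<and> 0 \<notin> S \<and>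
     pairwise (\<lambda>u v. independent {u, v}) S \<and> span S = UNIV"

definition not_determined_by_xrays :: "'a::real_vector set \<Rightarrow> nat \<Rightarrow> nat \<Rightarrow> bool" where
  "not_determined_by_xrays A m n \<longleftrightarrow>
     (\<exists>S. admissible_directions m S \<and>
       (\<exists>F G. F \<subseteq> A \<and> G \<subseteq> A \<and> finite F \<and> finite G \<and> card F = n \<and> card G = n \<and> F \<noteq> G \<and>
          (\<forall>s\<in>S. xray s F = xray s G)))"

text \<open>
  The minimum is taken in the extended naturals, so that it is \<open>\<infinity>\<close> if there is no such \<open>n\<close>
  (as for \<open>m\<close> smaller than the dimension). A finite upper bound thus includes existence.
\<close>

definition psi :: "'a::real_vector set \<Rightarrow> nat \<Rightarrow> enat" where
  "psi A m = Inf (enat ` {n. not_determined_by_xrays A m n})"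

end

theory Submission
  imports Defs "HOL-Real_Asymp.Real_Asymp"
begin

text \<open>
  The proof counts. Let \<open>d\<close> be the dimension, and consider the subsets of the box \<open>B\<close> of all
  lattice points with coordinates in \<open>{0,\<dots>,N-1}\<close>; there are \<open>2 ^ N\<^sup>d\<close> of them. If \<open>m\<close>
  directions produce fewer than \<open>2 ^ N\<^sup>d\<close> different families of X-rays on these subsets, then
  two different subsets of \<open>B\<close> have the same X-rays. Equal X-rays force equal
  cardinality, and this cardinality is at most \<open>N\<^sup>d\<close>, so \<open>psi\<close> is at most \<open>N\<^sup>d\<close>.

  The number of X-ray families is small if few lines meet \<open>B\<close>, and this holds for short
  directions: if a direction has entries in \<open>{0,\<dots>,R}\<close>, then every line in this direction
  that meets \<open>B\<close> contains a point of \<open>B\<close> with a coordinate below \<open>R\<close>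
  (\<open>line_meets_entry_layer\<close>), and there are at most \<open>d * R * N ^ (d - 1)\<close> such points. On each
  line the X-ray takes at most \<open>N\<^sup>d + 1\<close> values. By \<open>pigeonhole_equal_xrays\<close> it suffices that
  \<open>(N\<^sup>d + 1) ^ (m * d * R * N ^ (d - 1)) < 2 ^ N\<^sup>d\<close>, which follows if \<open>N\<close> exceeds
  \<open>m * d\<^sup>2 * R * log 2 (N + 1)\<close>.

  It remains to find \<open>m\<close> pairwise nonparallel short directions. A positive proportion of the
  vectors with entries in \<open>{1,\<dots>,R}\<close> has coprime entries at two chosen places
  (\<open>card_coprime_vectors\<close>), and such vectors are pairwise independent, so \<open>R\<close> can be of order
  \<open>m powr (1 / d)\<close>; the unit vectors are added to make the directions span the space. Then
  \<open>N\<close> may be taken of order \<open>m powr (1 + 1 / d + \<epsilon> / d)\<close>, since the surplus power of \<open>m\<close>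
  outgrows the logarithm, and \<open>N\<^sup>d\<close> is of order \<open>m powr (d + 1 + \<epsilon>)\<close>.
\<close>

section \<open>Lines and X-rays\<close>

lemma line_eq_of_shift:
  fixes p s :: "'a::real_vector"
  shows "range (\<lambda>t::real. (p + c *\<^sub>R s) + t *\<^sub>R s) = range (\<lambda>t::real. p + t *\<^sub>R s)"
proof -
  have "(\<lambda>t::real. (p + c *\<^sub>R s) + t *\<^sub>R s) = (\<lambda>t. p + t *\<^sub>R s) \<circ> (\<lambda>t. c + t)"
    by (auto simp: fun_eq_iff scaleR_add_left)
  then show ?thesis
    by (metis image_comp surj_plus)
qed

lemma line_through_point:
  assumes "L \<in> lines_parallel s" "p \<in> L"
  shows "L = range (\<lambda>t::real. p + t *\<^sub>R s)"
proof -
  obtain q where q: "L = range (\<lambda>t::real. q + t *\<^sub>R s)"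
    using assms(1) unfolding lines_parallel_def by blast
  then obtain c where "p = q + c *\<^sub>R s"
    using assms(2) by blast
  then show ?thesis
    using line_eq_of_shift[of q c s] q by simp
qed

lemma xray_eq_iff:
  "xray s F = xray s G \<longleftrightarrow> (\<forall>L\<in>lines_parallel s. card (F \<inter> L) = card (G \<inter> L))"
  by (auto simp: xray_def fun_eq_iff restrict_def)

lemma card_eq_sum_over_lines:
  fixes s :: "'a::real_vector"
  assumes "finite A" "F \<subseteq> A"
  shows "card F = (\<Sum>L\<in>(\<lambda>p. range (\<lambda>t::real. p + t *\<^sub>R s)) ` A. card (F \<inter> L))"
    (is "_ = sum _ (?l ` A)")
proof -
  have line: "?l p \<in> lines_parallel s" for p
    unfolding lines_parallel_def by blast
  have self: "p \<in> ?l p" for p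
    by (rule range_eqI[of _ _ 0]) simp
  have "F = (\<Union>L\<in>?l ` A. F \<inter> L)"
    using self assms(2) by (simp only: UN_simps) fast
  moreover have "card (\<Union>L\<in>?l ` A. F \<inter> L) = (\<Sum>L\<in>?l ` A. card (F \<inter> L))"
  proof (rule card_UN_disjoint)
    show "\<forall>L\<in>?l ` A. \<forall>M\<in>?l ` A. L \<noteq> M \<longrightarrow> (F \<inter> L) \<inter> (F \<inter> M) = {}"
    proof (intro ballI impI)
      fix L M assume "L \<in> ?l ` A" "M \<in> ?l ` A" and neq: "L \<noteq> M"
      then have LM: "L \<in> lines_parallel s" "M \<in> lines_parallel s"
        using line by auto
      have "L = M" if "p \<in> L" "p \<in> M" for p
        using line_through_point[OF LM(1) that(1)] line_through_point[OF LM(2) that(2)] by simp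
      with neq show "(F \<inter> L) \<inter> (F \<inter> M) = {}"
        by blast
    qed
  qed (use assms finite_subset in auto)
  ultimately show ?thesis by simp
qed

text \<open>
  The lines parallel to \<open>s\<close> partition the space, so an X-ray determines the number of points.
\<close>

lemma card_eq_if_xray_eq:
  assumes "finite F" "finite G" "xray s F = xray s G"
  shows "card F = card G"
proof -
  have "card (F \<inter> L) = card (G \<inter> L)"
    if "L \<in> (\<lambda>p. range (\<lambda>t::real. p + t *\<^sub>R s)) ` (F \<union> G)" for L
    using that assms(3) unfolding xray_eq_iff lines_parallel_def by blast
  then show ?thesis
    using card_eq_sum_over_lines[of "F \<union> G" F s] card_eq_sum_over_lines[of "F \<union> G" G s] assms
    by simp
qed

text \<open>
  All X-rays of a subset of \<open>A\<close> are recorded by at most \<open>card S * card E\<close> numbers, each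
  at most \<open>card A\<close>, as soon as every line in play passes through the set \<open>E\<close>. If there are
  more subsets than possible records, two subsets share a record.
\<close>

lemma pigeonhole_equal_xrays:
  fixes A S E :: "'a::real_vector set"
  assumes fin: "finite A" "finite S" "finite E"
    and hit: "\<And>s p. s \<in> S \<Longrightarrow> p \<in> A \<Longrightarrow> \<exists>q\<in>E. \<exists>c::real. p = q + c *\<^sub>R s"
    and few: "(card A + 1) ^ (card S * card E) < 2 ^ card A"
  obtains F G where "F \<subseteq> A" "G \<subseteq> A" "F \<noteq> G" "\<And>s. s \<in> S \<Longrightarrow> xray s F = xray s G"
proof -
  define rec where "rec F =
    restrict (\<lambda>(s, q). card (F \<inter> range (\<lambda>t::real. q + t *\<^sub>R s))) (S \<times> E)" for F
  define Rec where "Rec = (S \<times> E) \<rightarrow>\<^sub>E {..card A}"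
  have "rec F \<in> Rec" if "F \<subseteq> A" for F
  proof -
    have "card (F \<inter> L) \<le> card A" for L
      using that fin(1) by (meson card_mono Int_lower1 order_trans)
    then show ?thesis
      unfolding rec_def Rec_def by (auto simp: restrict_PiE_iff)
  qed
  then have "card (rec ` Pow A) \<le> card Rec"
    using fin unfolding Rec_def by (intro card_mono finite_PiE) auto
  also have "card Rec = (card A + 1) ^ (card S * card E)"
    using fin by (simp add: Rec_def card_PiE card_cartesian_product)
  also have "\<dots> < card (Pow A)"
    using few fin by (simp add: card_Pow)
  finally have "\<not> inj_on rec (Pow A)"
    by (rule pigeonhole)
  then obtain F G where FG: "F \<subseteq> A" "G \<subseteq> A" "F \<noteq> G" "rec F = rec G"
    unfolding inj_on_def by blast
  have "xray s F = xray s G" if s: "s \<in> S" for s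
    unfolding xray_eq_iff
  proof
    fix L assume L: "L \<in> lines_parallel s"
    show "card (F \<inter> L) = card (G \<inter> L)"
    proof (cases "A \<inter> L = {}")
      case True
      then have "F \<inter> L = {}" "G \<inter> L = {}" using FG by auto
      then show ?thesis by simp
    next
      case False
      then obtain p where p: "p \<in> A" "p \<in> L" by blast
      obtain q c where q: "q \<in> E" "p = q + c *\<^sub>R s"
        using hit[OF s p(1)] by blast
      have "L = range (\<lambda>t::real. q + t *\<^sub>R s)"
        using line_through_point[OF L p(2)] line_eq_of_shift[of q c s] q(2) by simp
      then show ?thesis
        using fun_cong[OF FG(4), of "(s, q)"] s q(1) by (simp add: rec_def)
    qed
  qed
  with FG that show thesis by blast
qed

section \<open>Lines through a box\<close>

definition nat_vec :: "('d::finite \<Rightarrow> nat) \<Rightarrow> real ^ 'd" where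
  "nat_vec f = (\<chi> i. real (f i))"

lemma nat_vec_nth [simp]: "nat_vec f $ i = real (f i)"
  by (simp add: nat_vec_def)

lemma inj_nat_vec: "inj nat_vec"
  by (auto simp: inj_def vec_eq_iff fun_eq_iff)

definition nat_box :: "nat \<Rightarrow> (real ^ 'd::finite) set" where
  "nat_box N = nat_vec ` (UNIV \<rightarrow>\<^sub>E {..<N})"

text \<open>
  For directions with entries in \<open>{0,\<dots>,R}\<close>, the points of the box at which a line can enter it.
  If \<open>R > N\<close>, this set sticks out of the box, which is harmless as only its size matters and the
  formula for the size needs no case distinction.
\<close>

definition entry_layer :: "nat \<Rightarrow> nat \<Rightarrow> (real ^ 'd::finite) set" where
  "entry_layer R N = (\<Union>a. nat_vec ` (\<Pi>\<^sub>E i\<in>UNIV. if i = a then {..<R} else {..<N}))"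

lemma nat_box_subset_lattice: "nat_box N \<subseteq> integer_lattice"
  by (auto simp: nat_box_def integer_lattice_def)

lemma finite_nat_box: "finite (nat_box N)"
  by (auto simp: nat_box_def intro!: finite_PiE)

lemma card_nat_box: "card (nat_box N :: (real ^ 'd::finite) set) = N ^ CARD('d)"
  by (simp add: nat_box_def card_image inj_on_subset[OF inj_nat_vec] card_PiE)

lemma finite_entry_layer: "finite (entry_layer R N)"
  by (auto simp: entry_layer_def intro!: finite_PiE)

lemma card_entry_layer:
  "card (entry_layer R N :: (real ^ 'd::finite) set) \<le> CARD('d) * (R * N ^ (CARD('d) - 1))"
proof -
  have "card (nat_vec ` (\<Pi>\<^sub>E i\<in>UNIV. if i = a then {..<R} else {..<N}))
      = R * N ^ (CARD('d) - 1)" for a :: 'd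
  proof -
    have "card (nat_vec ` (\<Pi>\<^sub>E i\<in>UNIV. if i = a then {..<R} else {..<N}))
        = (\<Prod>i\<in>UNIV. if i = a then R else N)"
      by (simp add: card_image inj_on_subset[OF inj_nat_vec] card_PiE if_distrib cong: if_cong)
    also have "\<dots> = R * (\<Prod>i\<in>UNIV - {a}. if i = a then R else N)"
      by (subst prod.remove[of _ a]) auto
    also have "(\<Prod>i\<in>UNIV - {a}. if i = a then R else N) = (\<Prod>i\<in>UNIV - {a}. N)"
      by (rule prod.cong) auto
    finally show ?thesis by (simp add: card_Diff_singleton)
  qed
  then show ?thesis
    unfolding entry_layer_def
    using card_UN_le[of "UNIV :: 'd set"
        "\<lambda>a. nat_vec ` (\<Pi>\<^sub>E i\<in>UNIV. if i = a then {..<R} else {..<N})"]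
    by simp
qed

text \<open>
  Step back along the direction for as long as all coordinates stay nonnegative. At the last
  point some coordinate is too small for a further step, hence less than \<open>R\<close>.
\<close>

lemma line_meets_entry_layer:
  fixes v :: "'d::finite \<Rightarrow> nat"
  assumes "v \<noteq> (\<lambda>_. 0)" "\<And>i. v i \<le> R" "p \<in> nat_box N"
  shows "\<exists>q\<in>entry_layer R N. \<exists>c::real. p = q + c *\<^sub>R nat_vec v"
proof -
  obtain f where f: "p = nat_vec f" "\<And>i. f i < N"
    using assms(3) by (auto simp: nat_box_def)
  have "(\<And>i. f i < N) \<Longrightarrow> \<exists>q\<in>entry_layer R N. \<exists>c::real. nat_vec f = q + c *\<^sub>R nat_vec v" for f
  proof (induction f rule: measure_induct_rule[of "\<lambda>f. \<Sum>i\<in>UNIV. f i"])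
    case (less f)
    show ?case
    proof (cases "\<exists>a. f a < v a")
      case True
      then obtain a where "f a < R" using assms(2) less_le_trans by blast
      then have "nat_vec f \<in> entry_layer R N"
        using less.prems by (auto simp: entry_layer_def intro!: exI[of _ a] imageI)
      then show ?thesis
        by (intro bexI[of _ "nat_vec f"] exI[of _ 0]) auto
    next
      case False
      then have le: "v i \<le> f i" for i by (simp add: not_less)
      define g where "g i = f i - v i" for i
      obtain a where "v a \<noteq> 0" using assms(1) by auto
      then have "sum g UNIV < sum f UNIV"
        using le[of a] by (intro sum_strict_mono_ex1) (auto simp: g_def intro!: exI[of _ a])
      moreover have "g i < N" for i
        using less.prems[of i] by (simp add: g_def)
      ultimately obtain q c where q: "q \<in> entry_layer R N" "nat_vec g = q + c *\<^sub>R nat_vec v"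
        using less.IH by blast
      have "nat_vec f = nat_vec g + nat_vec v"
        using le by (auto simp: vec_eq_iff g_def of_nat_diff)
      also have "\<dots> = q + (c + 1) *\<^sub>R nat_vec v"
        by (simp add: q(2) scaleR_add_left)
      finally show ?thesis using q(1) by blast
    qed
  qed
  with f show ?thesis by blast
qed

section \<open>Many short directions\<close>

text \<open>All independence claims about pairs of directions come down to a nonzero minor.\<close>

lemma independent_pair_if_minor:
  fixes u v :: "real ^ 'd"
  assumes "u $ i * v $ j \<noteq> u $ j * v $ i"
  shows "independent {u, v}"
proof -
  have "v \<noteq> 0" using assms by auto
  moreover have "u \<notin> span {v}"
    using assms by (auto simp: span_singleton)
  ultimately show ?thesis
    by (simp add: independent_insert)
qed

definition coprime_vectors :: "'d \<Rightarrow> 'd \<Rightarrow> nat \<Rightarrow> ('d::finite \<Rightarrow> nat) set" where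
  "coprime_vectors a b R = {f \<in> UNIV \<rightarrow>\<^sub>E {1..R}. coprime (f a) (f b)}"

lemma finite_coprime_vectors: "finite (coprime_vectors a b R)"
  unfolding coprime_vectors_def by (rule finite_subset[of _ "UNIV \<rightarrow>\<^sub>E {1..R}"]) (auto intro: finite_PiE)

text \<open>
  If the entries at \<open>a\<close> and \<open>b\<close> are proportional, they agree by coprimality. The two vectors
  then differ at another place \<open>k\<close>, and the minor at \<open>a\<close> and \<open>k\<close> does not vanish.
\<close>

lemma independent_coprime_vectors:
  assumes f: "f \<in> coprime_vectors a b R" and g: "g \<in> coprime_vectors a b R" and "f \<noteq> g"
  shows "independent {nat_vec f, nat_vec g}"
proof (cases "f a * g b = f b * g a")
  case False
  then have "real (f a) * real (g b) \<noteq> real (f b) * real (g a)"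
    by (metis of_nat_eq_iff of_nat_mult)
  then show ?thesis
    by (intro independent_pair_if_minor[of _ a _ b]) simp
next
  case True
  have cop: "coprime (f a) (f b)" "coprime (g a) (g b)"
    using f g by (auto simp: coprime_vectors_def)
  \<comment> \<open>As \<open>f a\<close> divides \<open>f b * g a\<close> and is coprime to \<open>f b\<close>, it divides \<open>g a\<close>; and symmetrically.\<close>
  have "f a dvd g a" "g a dvd f a"
    using True cop by (metis coprime_dvd_mult_right_iff dvd_triv_left,
        metis coprime_dvd_mult_left_iff dvd_triv_right)
  then have eq: "f a = g a" by (rule dvd_antisym)
  obtain k where k: "f k \<noteq> g k" using assms(3) by auto
  have "f a > 0" using f by (auto simp: coprime_vectors_def PiE_iff Suc_le_eq)
  then have "real (f a) * real (g k) \<noteq> real (f k) * real (g a)"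
    using k eq by simp
  then show ?thesis
    by (intro independent_pair_if_minor[of _ a _ k]) simp
qed

lemma sum_inverse_squares_le: "(\<Sum>k=2..n. 1 / (real k)\<^sup>2) \<le> 3/4"
proof (cases "n \<ge> 2")
  case True
  \<comment> \<open>The first term is kept as \<open>1 / 4\<close>; the others are compared with a telescoping sum.\<close>
  then have "(\<Sum>k=2..n. 1 / (real k)\<^sup>2) \<le> 3/4 - 1 / real n"
  proof (induction n rule: dec_induct)
    case base
    then show ?case by simp
  next
    case (step n)
    have "1 / (real (Suc n))\<^sup>2 \<le> 1 / (real n * real (Suc n))"
      using step.hyps by (intro divide_left_mono) (auto simp: power2_eq_square)
    also have "\<dots> = 1 / real n - 1 / real (Suc n)"
      using step.hyps by (simp add: field_simps)
    finally show ?case using step by simp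
  qed
  then show ?thesis
    by (smt (verit) divide_nonneg_nonneg of_nat_0_le_iff)
qed simp

text \<open>
  The vectors whose entries at \<open>a\<close> and \<open>b\<close> share a divisor \<open>k \<ge> 2\<close> make up a proportion of
  at most \<open>1 / k\<^sup>2\<close> of the box, and these proportions add up to at most \<open>3 / 4\<close>.
\<close>

lemma card_coprime_vectors:
  fixes a b :: "'d::finite"
  assumes "a \<noteq> b"
  shows "R ^ CARD('d) \<le> 4 * card (coprime_vectors a b R)"
proof -
  define D where
    "D k = (\<Pi>\<^sub>E i\<in>(UNIV::'d set). if i \<in> {a, b} then (*) k ` {1..R div k} else {1..R})" for k
  have d2: "CARD('d) \<ge> 2"
    using card_mono[of "UNIV :: 'd set" "{a, b}"] assms by simp
  have card_D: "card (D k) = (R div k)\<^sup>2 * R ^ (CARD('d) - 2)" if "k \<ge> 2" for k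
  proof -
    have "card (D k) = (\<Prod>i\<in>UNIV. if i \<in> {a, b} then R div k else R)"
      using that
      by (simp add: D_def card_PiE if_distrib card_image inj_on_def cong: if_cong)
    also have "\<dots> = (\<Prod>i\<in>{a, b}. R div k) * (\<Prod>i\<in>- {a, b}. R)"
      by (simp add: prod.If_cases del: insert_iff)
    also have "\<dots> = (R div k)\<^sup>2 * R ^ (CARD('d) - 2)"
      using assms by (simp add: Compl_eq_Diff_UNIV card_Diff_subset power2_eq_square numeral_2_eq_2)
    finally show ?thesis .
  qed
  have "(UNIV \<rightarrow>\<^sub>E {1..R}) \<subseteq> coprime_vectors a b R \<union> (\<Union>k\<in>{2..R}. D k)"
  proof
    fix f :: "'d \<Rightarrow> nat" assume f: "f \<in> UNIV \<rightarrow>\<^sub>E {1..R}"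
    then have range: "1 \<le> f i" "f i \<le> R" for i by (auto simp: PiE_iff)
    show "f \<in> coprime_vectors a b R \<union> (\<Union>k\<in>{2..R}. D k)"
    proof (cases "coprime (f a) (f b)")
      case True
      with f show ?thesis by (simp add: coprime_vectors_def)
    next
      case False
      define k where "k = gcd (f a) (f b)"
      have "k \<noteq> 0" "k \<noteq> 1"
        using range(1)[of a] False by (auto simp: k_def coprime_iff_gcd_eq_1)
      moreover have "k \<le> f a"
        using range(1)[of a] by (simp add: k_def gcd_le1_nat)
      ultimately have k: "k \<in> {2..R}"
        using range(2)[of a] by simp
      have "f i \<in> (*) k ` {1..R div k}" if "k dvd f i" for i
      proof -
        from that obtain c where c: "f i = k * c" by blast
        then have "c \<noteq> 0" "c \<le> R div k"
          using range[of i] k by (auto simp: less_eq_div_iff_mult_less_eq mult.commute)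
        with c show ?thesis by (auto intro!: imageI simp: Suc_le_eq)
      qed
      then have "f \<in> D k"
        using range unfolding D_def by (simp add: PiE_iff k_def)
      with k show ?thesis by blast
    qed
  qed
  then have "card (UNIV \<rightarrow>\<^sub>E {1..R} :: ('d \<Rightarrow> nat) set)
      \<le> card (coprime_vectors a b R \<union> (\<Union>k\<in>{2..R}. D k))"
    by (intro card_mono) (auto simp: D_def finite_coprime_vectors intro!: finite_PiE)
  also have "\<dots> \<le> card (coprime_vectors a b R) + (\<Sum>k=2..R. card (D k))"
    by (intro order_trans[OF card_Un_le] add_left_mono card_UN_le) simp
  finally have "R ^ CARD('d)
      \<le> card (coprime_vectors a b R) + (\<Sum>k=2..R. (R div k)\<^sup>2 * R ^ (CARD('d) - 2))"
    by (simp add: card_PiE card_D)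
  then have "real R ^ CARD('d) \<le> real (card (coprime_vectors a b R))
      + (\<Sum>k=2..R. (real (R div k))\<^sup>2 * real R ^ (CARD('d) - 2))"
    by (simp flip: of_nat_power of_nat_mult of_nat_sum of_nat_add)
  also have "(\<Sum>k=2..R. (real (R div k))\<^sup>2 * real R ^ (CARD('d) - 2))
      \<le> (\<Sum>k=2..R. (real R / real k)\<^sup>2 * real R ^ (CARD('d) - 2))"
    by (intro sum_mono mult_right_mono power_mono) (auto simp: of_nat_div_le_of_nat)
  also have "\<dots> = real R ^ CARD('d) * (\<Sum>k=2..R. 1 / (real k)\<^sup>2)"
  proof -
    have "real R ^ CARD('d) = (real R)\<^sup>2 * real R ^ (CARD('d) - 2)"
      using d2 by (metis le_add_diff_inverse power_add)
    then show ?thesis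
      by (simp only: sum_distrib_left power_divide times_divide_eq_left times_divide_eq_right
          mult_1_right)
  qed
  also have "\<dots> \<le> real R ^ CARD('d) * (3 / 4)"
    by (intro mult_left_mono sum_inverse_squares_le) simp
  finally have "real R ^ CARD('d) \<le> 4 * real (card (coprime_vectors a b R))"
    by simp
  then show ?thesis
    by (simp flip: of_nat_power of_nat_le_iff[where ?'a = real])
qed

text \<open>
  The unit vectors provide the spanning property, and vectors with a coprime pair of entries
  fill up the required number.
\<close>

lemma short_admissible_directions:
  assumes d: "2 \<le> CARD('d::finite)" "CARD('d) \<le> m" and R: "4 * m \<le> R ^ CARD('d)"
  obtains V :: "('d::finite \<Rightarrow> nat) set"
  where "admissible_directions m (nat_vec ` V)" "finite V"
    "\<And>v. v \<in> V \<Longrightarrow> v \<noteq> (\<lambda>_. 0)" "\<And>v i. v \<in> V \<Longrightarrow> v i \<le> R"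
proof -
  define unit :: "'d \<Rightarrow> 'd \<Rightarrow> nat" where "unit c i = (if i = c then 1 else 0)" for c i
  obtain P :: "'d set" where "card P = 2"
    using obtain_subset_with_card_n[OF d(1)] by blast
  then obtain a b :: 'd where ab: "a \<noteq> b"
    by (auto simp: card_2_iff)
  have "R \<noteq> 0"
    using R d by (intro notI) (simp add: power_0_left)
  have "m - CARD('d) \<le> card (coprime_vectors a b R)"
    using card_coprime_vectors[OF ab, of R] R by linarith
  then obtain T where T: "T \<subseteq> coprime_vectors a b R" "card T = m - CARD('d)" "finite T"
    by (rule obtain_subset_with_card_n)
  have T_entry: "1 \<le> f i" "f i \<le> R" if "f \<in> T" for f i
    using that T(1) by (auto simp: coprime_vectors_def PiE_iff)
  have other: "\<exists>j. j \<noteq> c" for c :: 'd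
    using ab by metis
  have "inj unit"
    by (intro injI) (metis unit_def zero_neq_one)
  have disj: "range unit \<inter> T = {}"
  proof -
    have "unit c \<notin> T" for c
    proof
      assume "unit c \<in> T"
      moreover obtain j where "j \<noteq> c" using other by blast
      ultimately show False
        using T_entry(1)[of "unit c" j] by (simp add: unit_def)
    qed
    then show ?thesis by auto
  qed
  define V where "V = range unit \<union> T"
  have finV: "finite V" using T(3) by (simp add: V_def)
  have nz: "v \<noteq> (\<lambda>_. 0)" if "v \<in> V" for v
  proof -
    have "\<exists>i. v i \<ge> 1"
    proof (cases "v \<in> T")
      case True
      then show ?thesis using T_entry(1) by blast
    next
      case False
      then show ?thesis using that by (auto simp: V_def unit_def)
    qed
    then show ?thesis by auto
  qed
  have le: "v i \<le> R" if "v \<in> V" for v i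
    using that T_entry(2) \<open>R \<noteq> 0\<close> by (auto simp: V_def unit_def)
  have "card V = m"
    using d disj T \<open>inj unit\<close> by (simp add: V_def card_Un_disjoint card_image)
  then have "card (nat_vec ` V) = m"
    by (simp add: card_image inj_on_subset[OF inj_nat_vec])
  moreover have "0 \<notin> nat_vec ` V"
  proof
    assume "0 \<in> nat_vec ` V"
    then obtain v where "v \<in> V" "nat_vec v = 0" by auto
    moreover from this have "v = (\<lambda>_. 0)"
      by (auto simp: vec_eq_iff fun_eq_iff)
    ultimately show False using nz by blast
  qed
  moreover have "span (nat_vec ` V) = UNIV"
  proof -
    have "nat_vec (unit c) = axis c 1" for c
      by (auto simp: vec_eq_iff unit_def axis_def)
    then have "Basis \<subseteq> nat_vec ` V"
      by (auto simp: Basis_vec_def V_def image_Un image_image)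
    then show ?thesis
      using span_mono[of Basis "nat_vec ` V"] span_Basis by blast
  qed
  moreover have "pairwise (\<lambda>u v. independent {u, v}) (nat_vec ` V)"
  proof (rule pairwise_imageI)
    have unit_any: "independent {nat_vec (unit c), nat_vec g}"
      if "g \<in> V" "unit c \<noteq> g" for c g
    proof -
      have "\<exists>j. j \<noteq> c \<and> g j \<noteq> 0"
      proof (cases "g \<in> T")
        case True
        obtain j where "j \<noteq> c" using other by blast
        moreover have "g j \<noteq> 0" using T_entry(1)[OF True, of j] by simp
        ultimately show ?thesis by blast
      next
        case False
        with that(1) obtain c' where "g = unit c'" by (auto simp: V_def)
        then show ?thesis using that(2) by (intro exI[of _ c']) (auto simp: unit_def)
      qed
      then obtain j where "j \<noteq> c" "g j \<noteq> 0" by blast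
      then show ?thesis
        by (intro independent_pair_if_minor[of _ c _ j]) (simp add: unit_def)
    qed
    fix f g assume fg: "f \<in> V" "g \<in> V" "f \<noteq> g"
    then consider c where "f = unit c" | c where "g = unit c" | "f \<in> T" "g \<in> T"
      by (auto simp: V_def)
    then show "independent {nat_vec f, nat_vec g}"
    proof cases
      case 1
      then show ?thesis using unit_any fg by blast
    next
      case 2
      then show ?thesis using unit_any fg by (metis insert_commute)
    next
      case 3
      then show ?thesis using independent_coprime_vectors T(1) fg(3) by blast
    qed
  qed
  ultimately have "admissible_directions m (nat_vec ` V)"
    using finV by (simp add: admissible_directions_def)
  then show thesis using that finV nz le by blast
qed

section \<open>The bound\<close>

text \<open>
  The counting argument for a box of side \<open>N\<close> and directions of size \<open>R\<close>. What remains
  afterwards is to choose \<open>R\<close> and \<open>N\<close> as functions of \<open>m\<close>.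
\<close>

lemma psi_lattice_le_box:
  assumes d: "2 \<le> CARD('d::finite)" "CARD('d) \<le> m" and R: "4 * m \<le> R ^ CARD('d)"
    and few: "(N ^ CARD('d) + 1) ^ (m * (CARD('d) * (R * N ^ (CARD('d) - 1)))) < 2 ^ N ^ CARD('d)"
  shows "psi (integer_lattice :: (real ^ 'd::finite) set) m \<le> enat (N ^ CARD('d))"
proof -
  let ?A = "nat_box N :: (real ^ 'd) set" and ?E = "entry_layer R N :: (real ^ 'd) set"
  obtain V :: "('d \<Rightarrow> nat) set" where V: "admissible_directions m (nat_vec ` V)" "finite V"
    "\<And>v. v \<in> V \<Longrightarrow> v \<noteq> (\<lambda>_. 0)" "\<And>v i. v \<in> V \<Longrightarrow> v i \<le> R"
    by (rule short_admissible_directions[OF d R]) blast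
  let ?S = "nat_vec ` V"
  have S: "card ?S = m" using V(1) by (simp add: admissible_directions_def)
  obtain F G where FG: "F \<subseteq> ?A" "G \<subseteq> ?A" "F \<noteq> G" "\<And>s. s \<in> ?S \<Longrightarrow> xray s F = xray s G"
  proof (rule pigeonhole_equal_xrays[of ?A ?S ?E])
    show "\<exists>q\<in>?E. \<exists>c::real. p = q + c *\<^sub>R s" if "s \<in> ?S" "p \<in> ?A" for s p
      using that V(3,4) line_meets_entry_layer by blast
    have "(card ?A + 1) ^ (card ?S * card ?E)
        \<le> (N ^ CARD('d) + 1) ^ (m * (CARD('d) * (R * N ^ (CARD('d) - 1))))"
      unfolding card_nat_box S by (intro power_increasing mult_left_mono card_entry_layer) auto
    with few show "(card ?A + 1) ^ (card ?S * card ?E) < 2 ^ card ?A"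
      by (simp add: card_nat_box)
  qed (use V(2) finite_nat_box finite_entry_layer in auto)
  have fin: "finite F" "finite G" using FG finite_nat_box finite_subset by blast+
  have "?S \<noteq> {}" using S d by auto
  then have "card F = card G"
    using FG(4) fin card_eq_if_xray_eq by blast
  then have "not_determined_by_xrays (integer_lattice :: (real ^ 'd) set) m (card F)"
    unfolding not_determined_by_xrays_def
    using V(1) FG fin nat_box_subset_lattice \<open>card F = card G\<close> by (metis subset_trans)
  then have "psi (integer_lattice :: (real ^ 'd) set) m \<le> enat (card F)"
    unfolding psi_def by (intro Inf_lower) auto
  also have "card F \<le> N ^ CARD('d)"
    using card_mono[OF finite_nat_box FG(1)] by (simp add: card_nat_box)
  finally show ?thesis by simp
qed

lemma power_less_two_power:
  fixes d K N :: nat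
  assumes "d > 0" "K * (d * log 2 (real N + 1)) < real N ^ d"
  shows "(N ^ d + 1) ^ K < 2 ^ N ^ d"
proof -
  have "N ^ d + 1 \<le> (N + 1) ^ d"
    using power_strict_mono[of N "N + 1" d] assms(1) by simp
  then have "real ((N ^ d + 1) ^ K) \<le> real (((N + 1) ^ d) ^ K)"
    unfolding of_nat_le_iff by (rule power_mono) simp
  also have "\<dots> = (real N + 1) ^ (d * K)"
    by (simp add: power_mult add.commute)
  also have "\<dots> = (2 powr log 2 (real N + 1)) ^ (d * K)"
    by simp
  also have "\<dots> = 2 powr (K * (d * log 2 (real N + 1)))"
    by (subst powr_power) (simp_all add: mult_ac del: powr_log_cancel)
  also have "\<dots> < 2 powr (real N ^ d)"
    using assms(2) by simp
  also have "\<dots> = real (2 ^ N ^ d)"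
    by (simp flip: of_nat_power add: powr_realpow)
  finally show ?thesis by (simp only: of_nat_less_iff)
qed

text \<open>
  With \<open>c = d\<^sup>2\<close>, \<open>k = 1 / d\<close>, \<open>e = \<epsilon> / d\<close> and \<open>x = m\<close>, the factor \<open>(4 * x) powr k + 1\<close> bounds
  \<open>R\<close>, the argument of the logarithm bounds \<open>N + 1\<close>, and the right-hand side is a lower bound
  of \<open>N\<close>. Rounding \<open>R\<close> and \<open>N\<close> up to integers costs at most \<open>1\<close> each.
\<close>

lemma side_length_eventually_suffices:
  fixes c k e :: real
  assumes "c > 0" "k > 0" "e > 0"
  shows "\<forall>\<^sub>F x in at_top. x * c * ((4 * x) powr k + 1) * log 2 (x powr (1 + k + e) + 2)
    < x powr (1 + k + e)"
  using assms by real_asymp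

theorem theorem3p3:
  fixes \<epsilon> :: real
  assumes "\<epsilon> > 0" and "CARD('d::finite) \<ge> 2"
  shows "\<exists>C::real. C > 0 \<and> (\<exists>m\<^sub>0::nat. \<forall>m\<ge>m\<^sub>0.
    ereal_of_enat (psi (integer_lattice :: (real ^ 'd) set) m)
      \<le> ereal (C * real m powr (real CARD('d) + 1 + \<epsilon>)))"
proof -
  define d where "d = CARD('d)"
  define k e where "k = 1 / real d" and "e = \<epsilon> / real d"
  define a where "a = 1 + k + e"
  have d: "d \<ge> 2" using assms(2) by (simp add: d_def)
  then have pos: "real d * real d > 0" "k > 0" "e > 0" "a > 0"
    using assms(1) by (auto simp: k_def e_def a_def add_pos_pos)
  have "\<forall>\<^sub>F m in sequentially. real m * (real d * real d) * ((4 * real m) powr k + 1)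
      * log 2 (real m powr a + 2) < real m powr a"
    using pos(1-3)
      eventually_compose_filterlim[OF side_length_eventually_suffices filterlim_real_sequentially]
    unfolding a_def by blast
  then obtain m1 where m1: "\<And>m. m \<ge> m1 \<Longrightarrow>
      real m * (real d * real d) * ((4 * real m) powr k + 1)
      * log 2 (real m powr a + 2) < real m powr a"
    unfolding eventually_sequentially by blast
  have "ereal_of_enat (psi (integer_lattice :: (real ^ 'd) set) m)
      \<le> ereal (2 ^ d * real m powr (real d + 1 + \<epsilon>))" if m: "m \<ge> max m1 d" for m
  proof -
    define R where "R = nat \<lceil>(4 * real m) powr k\<rceil>"
    define N where "N = nat \<lceil>real m powr a\<rceil>"
    have m_pos: "m \<ge> 1" and dm: "d \<le> m" using m d by auto
    \<comment> \<open>The factor \<open>4\<close> makes up for the proportion of coprime vectors, at least \<open>1 / 4\<close>.\<close>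
    have R: "(4 * real m) powr k \<le> real R" "real R \<le> (4 * real m) powr k + 1"
      unfolding R_def using powr_ge_zero[of "4 * real m" k] by linarith+
    have N: "real m powr a \<le> real N" "real N \<le> real m powr a + 1"
      unfolding N_def using powr_ge_zero[of "real m" a] by linarith+
    have ma: "real m powr a \<ge> 1"
      using m_pos pos(4) by (intro ge_one_powr_ge_zero) auto
    have "real (4 * m) = ((4 * real m) powr k) ^ d"
      using m_pos d by (simp add: powr_power k_def)
    also have "\<dots> \<le> real (R ^ d)"
      using R(1) by (simp add: power_mono)
    finally have R4: "4 * m \<le> R ^ d"
      by (simp only: of_nat_le_iff)
    have log: "log 2 (real N + 1) \<le> log 2 (real m powr a + 2)" "log 2 (real N + 1) \<ge> 0"
      using N ma by auto
    have "real m * (real d * real d) * real R * log 2 (real N + 1)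
        \<le> real m * (real d * real d) * ((4 * real m) powr k + 1) * log 2 (real m powr a + 2)"
      using R(2) log by (intro mult_mono mult_nonneg_nonneg) auto
    also have "\<dots> < real m powr a"
      using m1 m by simp
    also have "\<dots> \<le> real N" by (rule N(1))
    finally have "real m * (real d * real d) * real R * log 2 (real N + 1) < real N" .
    then have "(real m * (real d * real d) * real R * log 2 (real N + 1)) * real N ^ (d - 1)
        < real N * real N ^ (d - 1)"
      using N(1) ma by (intro mult_strict_right_mono) auto
    also have "\<dots> = real N ^ d"
      using d by (simp flip: power_Suc)
    finally have "real (m * (d * (R * N ^ (d - 1)))) * (real d * log 2 (real N + 1)) < real N ^ d"
      by (simp add: mult_ac)
    then have few: "(N ^ d + 1) ^ (m * (d * (R * N ^ (d - 1)))) < 2 ^ N ^ d"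
      using d by (intro power_less_two_power) auto
    have "psi (integer_lattice :: (real ^ 'd) set) m \<le> enat (N ^ d)"
      using psi_lattice_le_box[where 'd = 'd] assms(2) dm R4 few unfolding d_def by blast
    then have "ereal_of_enat (psi (integer_lattice :: (real ^ 'd) set) m)
        \<le> ereal_of_enat (enat (N ^ d))"
      by (simp only: ereal_of_enat_le_iff)
    also have "\<dots> = ereal (real N ^ d)" by simp
    also have "real N ^ d \<le> (2 * real m powr a) ^ d"
      using N(2) ma by (intro power_mono) auto
    also have "(2 * real m powr a) ^ d = 2 ^ d * real m powr (real d * a)"
      using m_pos by (simp add: power_mult_distrib powr_power mult.commute)
    also have "real d * a = real d + 1 + \<epsilon>"
      using d by (simp add: a_def k_def e_def field_simps)
    finally show ?thesis by simp
  qed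
  then show ?thesis
    unfolding d_def by (intro exI[of _ "2 ^ CARD('d)"] conjI exI[of _ "max m1 CARD('d)"]) auto
qed

end
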